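(* There is $\varepsilon_0>0$ such that for every $\varepsilon\in(0,\varepsilon_0)$ the following holds. For $\boldsymbol l\in\mathbb Z^2$ define the admissible angular frequencies and observation directions $$\omega_{\boldsymbol l}=\begin{cases}\dfrac{2\pi}{a}|\boldsymbol l|,&\boldsymbol l\neq\boldsymbol 0,\\[2mm] \dfrac{2\pi}{a}\varepsilon,&\boldsymbol l=\boldsymbol 0,\end{cases}\qquad \widehat x_{\boldsymbol l}=\begin{cases}\dfrac{\boldsymbol l}{|\boldsymbol l|},&\boldsymbol l\neq\boldsymbol 0,\\[2mm] (1,0)^\top,&\boldsymbol l=\boldsymbol 0.\end{cases}$$ Then the Fourier coefficients $\{\widehat{\boldsymbol g}_{\boldsymbol l}\}_{\boldsymbol l\in\mathbb Z^2}$ of the mean $\boldsymbol g$ of the random elastic source $\boldsymbol F=\boldsymbol g+\boldsymbol\sigma\dot W_x$ are determined by the multi-frequency mean data $\{\mathbf E[\boldsymbol u_\xi^\infty(\widehat x_{\boldsymbol l};c_\xi\omega_{\boldsymbol l})]:\xi\in\{p,s\},\ \boldsymbol l\in\mathbb Z^2\}$; that is, if two admissible sources, given by $(\boldsymbol g,\boldsymbol\sigma)$ and $(\boldsymbol g',\boldsymbol\sigma')$, with far-field patterns $\boldsymbol u_\xi^\infty$ and $\boldsymbol u_\xi'^\infty$, satisfy $\mathbf E[\boldsymbol u_\xi^\infty(\widehat x_{\boldsymbol l};c_\xi\omega_{\boldsymbol l})]=\mathbf E[\boldsymbol u_\xi'^\infty(\widehat x_{\boldsymbol l};c_\xi\omega_{\boldsymbol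 l})]$ for both $\xi\in\{p,s\}$ and all $\boldsymbol l\in\mathbb Z^2$, then $\widehat{\boldsymbol g}_{\boldsymbol l}=\widehat{\boldsymbol g'}_{\boldsymbol l}$ for all $\boldsymbol l\in\mathbb Z^2$.
   Context: Let $a>0$, $\Omega=(-a/2,a/2)\times(-a/2,a/2)\subset\mathbb R^2$ and $\mathbb S=\{x\in\mathbb R^2:|x|=1\}$ (directions are column vectors). Let $\lambda,\mu$ be fixed Lamé constants with $\mu>0$, $\lambda+\mu>0$, and $c_p=\sqrt{\lambda+2\mu}$, $c_s=\sqrt\mu$. For angular frequency $\omega>0$ put $k_p=\omega/c_p$, $k_s=\omega/c_s$, and $\gamma_\xi=\frac{\mathrm e^{\mathrm i\pi/4}}{\sqrt{8\pi k_\xi}}$ for $\xi\in\{p,s\}$. An admissible source is $\boldsymbol F=\boldsymbol g+\boldsymbol\sigma\dot W_x$, where $\boldsymbol g=(g_1,g_2)^\top$ is a deterministic real vector function, $\boldsymbol\sigma=\mathrm{diag}(\sigma_1,\sigma_2)$ is deterministic with $\sigma_1,\sigma_2\ge0$, all $g_j,\sigma_j$ are independent of $\omega$ and compactly supported in $\Omega$, with $g_j,\sigma_j^2\in L^2(\Omega)$, and $\dot W_x$ is white noise, the derivative of $W(x)=(W_1(x),W_2(x))^\top$ with $W_1,W_2$ independent one-dimensional two-parameter Brownian sheets. Integrals against $\mathrm dW_y$ are Wiener integrals. $\mathbf E$ denotes expectation. The displacement $\boldsymbol u$ solves $\mu\Delta\boldsymbol u+(\lambda+\mu)\nabla\nabla\cdot\boldsymbol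 u+\omega^2\boldsymbol u=-\boldsymbol F$ in $\mathbb R^2$, with its compressional and shear parts $\boldsymbol u_p,\boldsymbol u_s$ satisfying the Sommerfeld radiation condition $\lim_{r=|x|\to\infty}\sqrt r(\partial_r\boldsymbol u_\xi-\mathrm ik_\xi\boldsymbol u_\xi)=0$. Its compressional and shear far-field patterns at angular frequency $\omega$ in direction $\widehat x\in\mathbb S$ are $$\boldsymbol u_p^\infty(\widehat x;\omega)=\gamma_p\frac{k_p^2}{\omega^2}\int_\Omega\widehat x\widehat x^\top\mathrm e^{-\mathrm ik_p\widehat x\cdot y}\boldsymbol F(y)\,\mathrm dy,\qquad \boldsymbol u_s^\infty(\widehat x;\omega)=\gamma_s\frac{k_s^2}{\omega^2}\int_\Omega(\mathbb I-\widehat x\widehat x^\top)\mathrm e^{-\mathrm ik_s\widehat x\cdot y}\boldsymbol F(y)\,\mathrm dy,$$ where $\mathbb I$ is the $2\times2$ identity and $\boldsymbol F(y)\,\mathrm dy$ means $\boldsymbol g(y)\,\mathrm dy+\boldsymbol\sigma(y)\,\mathrm dW_y$. In the notation $\boldsymbol u_\xi^\infty(\widehat x;c_\xi\omega_{\boldsymbol l})$ the angular frequency is $c_\xi\omega_{\boldsymbol l}$, and $k_\xi,\gamma_\xi$ are taken at that frequency (so $k_\xi=\omega_{\boldsymbol l}$). The Fourier basis is $\phi_{\boldsymbol l}(x)=\mathrm e^{\mathrm i\frac{2\pi}{a}\boldsymbol l\cdot x}$, $\boldsymbol l\in\mathbb Z^2$, and $\widehat{\boldsymbol g}_{\boldsymbol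 l}=\frac1{a^2}\int_\Omega\boldsymbol g(x)\overline{\phi_{\boldsymbol l}(x)}\,\mathrm dx\in\mathbb C^2$. $|\boldsymbol l|$ is the Euclidean norm. *)

theory Defs
  imports "HOL-Probability.Probability"
begin

section \<open>Two-parameter Brownian sheets and Wiener integrals\<close>

text \<open>One-dimensional normal law \<open>N(m, v)\<close>, including the degenerate case \<open>v = 0\<close>,
  which has no density.\<close>

definition gaussian_rv :: "'w measure \<Rightarrow> ('w \<Rightarrow> real) \<Rightarrow> real \<Rightarrow> real \<Rightarrow> bool" where
  "gaussian_rv M X m v \<longleftrightarrow> X \<in> borel_measurable M \<and>
     (if v = 0 then AE w in M. X w = m
      else v > 0 \<and> distributed M lborel X (normal_density m (sqrt v)))"

definition gaussian_process :: "'w measure \<Rightarrow> ('t \<Rightarrow> 'w \<Rightarrow> real) \<Rightarrow> bool" where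
  "gaussian_process M X \<longleftrightarrow>
     (\<forall>T c. finite T \<longrightarrow> (\<exists>m v. gaussian_rv M (\<lambda>w. \<Sum>t\<in>T. c t * X t w) m v))"

text \<open>The sheet is indexed by the whole plane, since the domain of the source meets all four
  quadrants. The covariance of the values at \<open>x\<close> and \<open>y\<close> is the area of the intersection of the
  two axis-parallel rectangles with diagonals \<open>0x\<close> and \<open>0y\<close>; on a fixed quadrant this is the usual
  \<open>min |x\<^sub>1| |y\<^sub>1| * min |x\<^sub>2| |y\<^sub>2|\<close>, and values in different quadrants are independent.\<close>

definition sheet_cov :: "real^2 \<Rightarrow> real^2 \<Rightarrow> real" where
  "sheet_cov x y = (\<Prod>j\<in>UNIV. if x $ j * y $ j > 0 then min \<bar>x $ j\<bar> \<bar>y $ j\<bar> else 0)"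

definition brownian_sheet :: "'w measure \<Rightarrow> (real^2 \<Rightarrow> 'w \<Rightarrow> real) \<Rightarrow> bool" where
  "brownian_sheet M B \<longleftrightarrow>
     gaussian_process M B \<and>
     (\<forall>x. prob_space.expectation M (B x) = 0) \<and>
     (\<forall>x y. prob_space.expectation M (\<lambda>w. B x w * B y w) = sheet_cov x y) \<and>
     (AE w in M. continuous_on UNIV (\<lambda>x. B x w))"

text \<open>Independence is that of the two processes, i.e. of the random elements
  \<open>w \<mapsto> (x \<mapsto> W j x w)\<close> of the product space.\<close>

definition brownian_sheets :: "'w measure \<Rightarrow> (2 \<Rightarrow> real^2 \<Rightarrow> 'w \<Rightarrow> real) \<Rightarrow> bool" where
  "brownian_sheets M W \<longleftrightarrow>
     (\<forall>j. brownian_sheet M (W j)) \<and>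
     prob_space.indep_vars M (\<lambda>_. PiM UNIV (\<lambda>_. borel)) (\<lambda>j w x. W j x w) UNIV"

text \<open>A triple \<open>(c, p, q)\<close> with \<open>p \<le> q\<close> stands for the step \<open>c\<close> on the half-open rectangle
  \<open>(p\<^sub>1, q\<^sub>1] \<times> (p\<^sub>2, q\<^sub>2]\<close>.\<close>

type_synonym step = "complex \<times> (real^2) \<times> (real^2)"

definition step_fun :: "step list \<Rightarrow> real^2 \<Rightarrow> complex" where
  "step_fun s x = (\<Sum>(c, p, q)\<leftarrow>s. c * indicator {y. \<forall>i. p $ i < y $ i \<and> y $ i \<le> q $ i} x)"

definition sheet_increment :: "(real^2 \<Rightarrow> 'w \<Rightarrow> real) \<Rightarrow> real^2 \<Rightarrow> real^2 \<Rightarrow> 'w \<Rightarrow> real" where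
  "sheet_increment B p q w =
     B q w - B (vector [p $ 1, q $ 2]) w - B (vector [q $ 1, p $ 2]) w + B p w"

definition step_integral :: "(real^2 \<Rightarrow> 'w \<Rightarrow> real) \<Rightarrow> step list \<Rightarrow> 'w \<Rightarrow> complex" where
  "step_integral B s w = (\<Sum>(c, p, q)\<leftarrow>s. c * of_real (sheet_increment B p q w))"

text \<open>The Wiener integral is the mean-square limit of the integrals of step functions that
  approximate the integrand in \<open>L\<^sup>2(\<real>\<^sup>2)\<close>.\<close>

definition has_wiener_integral ::
  "'w measure \<Rightarrow> (real^2 \<Rightarrow> 'w \<Rightarrow> real) \<Rightarrow> (real^2 \<Rightarrow> complex) \<Rightarrow> ('w \<Rightarrow> complex) \<Rightarrow> bool" where
  "has_wiener_integral M B f J \<longleftrightarrow>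
     f \<in> borel_measurable lebesgue \<and> J \<in> borel_measurable M \<and>
     (\<exists>s. (\<forall>n. \<forall>(c, p, q)\<in>set (s n). p \<le> q) \<and>
          (\<lambda>n. \<integral>\<^sup>+ y. ennreal ((cmod (step_fun (s n) y - f y))\<^sup>2) \<partial>lebesgue) \<longlonglongrightarrow> 0 \<and>
          (\<lambda>n. \<integral>\<^sup>+ w. ennreal ((cmod (step_integral B (s n) w - J w))\<^sup>2) \<partial>M) \<longlonglongrightarrow> 0)"

text \<open>For \<open>B\<close> a Brownian sheet, the limit exists for every \<open>f\<close> in \<open>L\<^sup>2(\<real>\<^sup>2)\<close> and is unique up to
  almost sure equality, by the Wiener isometry; some version is chosen. As with the Bochner
  integral, the value is 0 when there is no limit.\<close>

definition wiener_integral ::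
  "'w measure \<Rightarrow> (real^2 \<Rightarrow> 'w \<Rightarrow> real) \<Rightarrow> (real^2 \<Rightarrow> complex) \<Rightarrow> 'w \<Rightarrow> complex" where
  "wiener_integral M B f =
     (if \<exists>J. has_wiener_integral M B f J then SOME J. has_wiener_integral M B f J else (\<lambda>_. 0))"


section \<open>Random elastic sources\<close>

definition square :: "real \<Rightarrow> (real^2) set" where
  "square a = {x. \<forall>j. - a / 2 < x $ j \<and> x $ j < a / 2}"

definition L2_on :: "(real^2) set \<Rightarrow> (real^2 \<Rightarrow> real) \<Rightarrow> bool" where
  "L2_on S f \<longleftrightarrow> set_borel_measurable lebesgue S f \<and> set_integrable lebesgue S (\<lambda>x. (f x)\<^sup>2)"

text \<open>Compactness of the essential support, as appropriate for \<open>L\<^sup>2\<close> functions.\<close>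

definition compactly_supported_in :: "(real^2) set \<Rightarrow> (real^2 \<Rightarrow> real) \<Rightarrow> bool" where
  "compactly_supported_in S f \<longleftrightarrow>
     (\<exists>K. compact K \<and> K \<subseteq> S \<and> (AE x in lebesgue. x \<notin> K \<longrightarrow> f x = 0))"

text \<open>The diagonal matrix field \<open>diag(\<sigma>\<^sub>1, \<sigma>\<^sub>2)\<close> is represented by the vector field of its diagonal
  entries.\<close>

definition admissible_source :: "real \<Rightarrow> (real^2 \<Rightarrow> real^2) \<Rightarrow> (real^2 \<Rightarrow> real^2) \<Rightarrow> bool" where
  "admissible_source a g \<sigma> \<longleftrightarrow>
     (\<forall>j. L2_on (square a) (\<lambda>x. g x $ j) \<and>
          compactly_supported_in (square a) (\<lambda>x. g x $ j) \<and>
          L2_on (square a) (\<lambda>x. (\<sigma> x $ j)\<^sup>2) \<and>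
          compactly_supported_in (square a) (\<lambda>x. \<sigma> x $ j) \<and>
          (AE x in lebesgue. 0 \<le> \<sigma> x $ j))"

text \<open>The integral of \<open>K(y) F(y) dy\<close> over the square, for a matrix kernel \<open>K\<close>, where \<open>F(y) dy\<close>
  means \<open>g(y) dy + \<sigma>(y) dW\<^sub>y\<close>.\<close>

definition source_integral ::
  "real \<Rightarrow> 'w measure \<Rightarrow> (2 \<Rightarrow> real^2 \<Rightarrow> 'w \<Rightarrow> real) \<Rightarrow> (real^2 \<Rightarrow> real^2) \<Rightarrow> (real^2 \<Rightarrow> real^2) \<Rightarrow>
   (real^2 \<Rightarrow> complex^2^2) \<Rightarrow> 'w \<Rightarrow> complex^2" where
  "source_integral a M W g \<sigma> K w = (\<chi> i.
     (LINT y:square a|lebesgue. (\<Sum>j\<in>UNIV. K y $ i $ j * of_real (g y $ j))) +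
     (\<Sum>j\<in>UNIV. wiener_integral M (W j)
        (\<lambda>y. indicator (square a) y * (K y $ i $ j * of_real (\<sigma> y $ j))) w))"


section \<open>Far-field patterns\<close>

datatype wave = Compressional | Shear

fun wave_speed :: "real \<Rightarrow> real \<Rightarrow> wave \<Rightarrow> real" where
  "wave_speed lam mu Compressional = sqrt (lam + 2 * mu)"
| "wave_speed lam mu Shear = sqrt mu"

definition wavenumber :: "real \<Rightarrow> real \<Rightarrow> wave \<Rightarrow> real \<Rightarrow> real" where
  "wavenumber lam mu \<xi> \<omega> = \<omega> / wave_speed lam mu \<xi>"

definition far_field_const :: "real \<Rightarrow> complex" where
  "far_field_const k = exp (\<i> * of_real (pi / 4)) / of_real (sqrt (8 * pi * k))"

text \<open>\<open>d d\<^sup>T\<close> and \<open>I - d d\<^sup>T\<close> for a direction \<open>d\<close>.\<close>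

fun polarization :: "wave \<Rightarrow> real^2 \<Rightarrow> real^2^2" where
  "polarization Compressional d = (\<chi> i j. d $ i * d $ j)"
| "polarization Shear d = mat 1 - (\<chi> i j. d $ i * d $ j)"

definition far_field ::
  "real \<Rightarrow> real \<Rightarrow> real \<Rightarrow> 'w measure \<Rightarrow> (2 \<Rightarrow> real^2 \<Rightarrow> 'w \<Rightarrow> real) \<Rightarrow>
   (real^2 \<Rightarrow> real^2) \<Rightarrow> (real^2 \<Rightarrow> real^2) \<Rightarrow> wave \<Rightarrow> real^2 \<Rightarrow> real \<Rightarrow> 'w \<Rightarrow> complex^2" where
  "far_field a lam mu M W g \<sigma> \<xi> d \<omega> w =
     (let k = wavenumber lam mu \<xi> \<omega> in
      (far_field_const k * of_real (k\<^sup>2 / \<omega>\<^sup>2)) *s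
      source_integral a M W g \<sigma>
        (\<lambda>y. \<chi> i j. of_real (polarization \<xi> d $ i $ j) * exp (- \<i> * of_real (k * (d \<bullet> y)))) w)"


section \<open>Fourier coefficients and measurement data\<close>

definition lattice_vec :: "int^2 \<Rightarrow> real^2" where
  "lattice_vec l = (\<chi> j. of_int (l $ j))"

definition fourier_basis :: "real \<Rightarrow> int^2 \<Rightarrow> real^2 \<Rightarrow> complex" where
  "fourier_basis a l x = exp (\<i> * of_real (2 * pi / a * (lattice_vec l \<bullet> x)))"

definition fourier_coeff :: "real \<Rightarrow> (real^2 \<Rightarrow> real^2) \<Rightarrow> int^2 \<Rightarrow> complex^2" where
  "fourier_coeff a g l = (\<chi> j. of_real (1 / a\<^sup>2) *
     (LINT x:square a|lebesgue. of_real (g x $ j) * cnj (fourier_basis a l x)))"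

definition admissible_freq :: "real \<Rightarrow> real \<Rightarrow> int^2 \<Rightarrow> real" where
  "admissible_freq a \<epsilon> l =
     (if l = 0 then 2 * pi / a * \<epsilon> else 2 * pi / a * norm (lattice_vec l))"

definition obs_dir :: "int^2 \<Rightarrow> real^2" where
  "obs_dir l = (if l = 0 then vector [1, 0] else lattice_vec l /\<^sub>R norm (lattice_vec l))"

text \<open>The angular frequency is \<open>c\<^sub>\<xi> \<omega>\<^sub>l\<close>, so that the wavenumber is \<open>\<omega>\<^sub>l\<close>.\<close>

definition mean_data ::
  "real \<Rightarrow> real \<Rightarrow> real \<Rightarrow> 'w measure \<Rightarrow> (2 \<Rightarrow> real^2 \<Rightarrow> 'w \<Rightarrow> real) \<Rightarrow> real \<Rightarrow>
   (real^2 \<Rightarrow> real^2) \<Rightarrow> (real^2 \<Rightarrow> real^2) \<Rightarrow> wave \<Rightarrow> int^2 \<Rightarrow> complex^2" where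
  "mean_data a lam mu M W \<epsilon> g \<sigma> \<xi> l =
     prob_space.expectation M
       (far_field a lam mu M W g \<sigma> \<xi> (obs_dir l) (wave_speed lam mu \<xi> * admissible_freq a \<epsilon> l))"

end

theory Submission
  imports Defs
begin

text \<open>A Wiener integral is an \<open>L\<^sup>2\<close>-limit of centred step integrals, hence centred, so the mean far field
  depends on \<open>g\<close> alone. For \<open>l \<noteq> 0\<close> the wavenumber times the direction is \<open>2 \<pi> l / a\<close>, and the
  compressional and shear data add up to the Fourier coefficient at \<open>l\<close>, as
  \<open>d d\<^sup>T + (I - d d\<^sup>T) = I\<close>.

  The coefficient at \<open>0\<close> follows from the others by compact support, without Fourier completeness.
  Suppose \<open>h\<close> has compact support in the open square and all its Fourier modes other than the zeroth
  vanish. With \<open>z = exp (-2 \<pi> i y\<^sub>1 / a)\<close>, the trigonometric polynomial \<open>z\<^sup>-\<^sup>n (1 - z)\<^sup>2\<^sup>n\<close> concentrates at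
  the boundary \<open>y\<^sub>1 = \<plusminus>a/2\<close>: on the support of \<open>h\<close> its modulus is at most \<open>r\<^sup>n\<close> with \<open>r < 4\<close>, while its
  zeroth coefficient has modulus \<open>(2n choose n) \<ge> 4\<^sup>n / (2n)\<close>. Integrating against \<open>h\<close> and letting
  \<open>n\<close> grow forces \<open>\<integral>h = 0\<close>.\<close>

section \<open>Means of Wiener integrals\<close>

lemma (in prob_space) gaussian_rv_integrable:
  assumes "gaussian_rv M X m v"
  shows "integrable M X"
proof (cases "v = 0")
  case True
  then have "AE w in M. X w = m" and [measurable]: "X \<in> borel_measurable M"
    using assms by (auto simp: gaussian_rv_def)
  then show ?thesis
    using integrable_cong_AE[of X M "\<lambda>_. m"] by auto
next
  case False
  then have D: "v > 0" "distributed M lborel X (normal_density m (sqrt v))"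
    using assms by (auto simp: gaussian_rv_def)
  show ?thesis
    by (rule distributed_integrable_var[OF D(2)]) (use D(1) in \<open>auto intro: integrable_normal_moment_nz_1\<close>)
qed

lemma (in prob_space) brownian_sheet_integrable:
  assumes "brownian_sheet M B"
  shows "integrable M (B x)"
proof -
  have "gaussian_process M B"
    using assms by (simp add: brownian_sheet_def)
  then have "\<exists>m v. gaussian_rv M (\<lambda>w. \<Sum>t\<in>{x}. (\<lambda>_. 1) t * B t w) m v"
    unfolding gaussian_process_def by (elim allE[of _ "{x}"] allE[of _ "\<lambda>_. 1"]) simp
  then show ?thesis
    by (auto dest: gaussian_rv_integrable)
qed

lemma (in prob_space) step_integral_expectation:
  assumes "brownian_sheet M B"
  shows "integrable M (step_integral B s)" "expectation (step_integral B s) = 0"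
proof -
  have I: "integrable M (B x)" for x
    using assms by (rule brownian_sheet_integrable)
  have Z: "expectation (B x) = 0" for x
    using assms by (simp add: brownian_sheet_def)
  have "integrable M (sheet_increment B p q)" "expectation (sheet_increment B p q) = 0" for p q
    unfolding sheet_increment_def using I Z by auto
  then have "integrable M (step_integral B s) \<and> expectation (step_integral B s) = 0"
    by (induction s) (auto simp: step_integral_def[abs_def] split_beta)
  then show "integrable M (step_integral B s)" "expectation (step_integral B s) = 0"
    by auto
qed

text \<open>On a probability space, mean-square convergence forces convergence of means. Since each
  approximating step integral is centred, the squared modulus of the mean of \<open>J\<close> is at
  most the mean-square error \<open>e n\<close>, which tends to 0.\<close>

lemma (in prob_space) has_wiener_integral_expectation:
  assumes B: "brownian_sheet M B" and J: "has_wiener_integral M B f J"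
  shows "integrable M J" "expectation J = 0"
proof -
  obtain s where lim: "(\<lambda>n. \<integral>\<^sup>+ w. ennreal ((cmod (step_integral B (s n) w - J w))\<^sup>2) \<partial>M) \<longlonglongrightarrow> 0"
    and J_meas [measurable]: "J \<in> borel_measurable M"
    using J unfolding has_wiener_integral_def by blast
  define S where "S n = step_integral B (s n)" for n
  define e where "e n = (\<integral>\<^sup>+ w. ennreal ((cmod (S n w - J w))\<^sup>2) \<partial>M)" for n
  have lim: "e \<longlonglongrightarrow> 0"
    unfolding e_def S_def by (rule lim)
  have S: "integrable M (S n)" "expectation (S n) = 0" for n
    using step_integral_expectation[OF B] by (auto simp: S_def)
  have [measurable]: "S n \<in> borel_measurable M" for n
    using S(1) by (rule borel_measurable_integrable)
  \<comment> \<open>The errors \<open>e n\<close> may be infinite for small \<open>n\<close>, so the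
    bound is restricted to finite ones. A single finite error already makes \<open>J\<close>
    integrable, as the difference of \<open>S n\<close> and \<open>S n - J\<close>.\<close>
  have bound: "integrable M J \<and> ennreal ((cmod (expectation J))\<^sup>2) \<le> e n" if "e n < top" for n
  proof -
    let ?D = "\<lambda>w. S n w - J w"
    have int2: "integrable M (\<lambda>w. (cmod (?D w))\<^sup>2)"
      by (rule integrableI_bounded) (use that in \<open>auto simp: e_def\<close>)
    then have int1: "integrable M (\<lambda>w. cmod (?D w))"
      by (rule square_integrable_imp_integrable[rotated]) measurable
    then have intD: "integrable M ?D"
      using integrable_norm_iff[of ?D M] by simp
    then have "integrable M (\<lambda>w. S n w - ?D w)"
      using S(1) by (rule Bochner_Integration.integrable_diff[rotated])
    then have intJ: "integrable M J" by simp
    have "expectation ?D = - expectation J"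
      using S intJ by simp
    then have "cmod (expectation J) \<le> expectation (\<lambda>w. cmod (?D w))"
      using integral_norm_bound[of M ?D] by simp
    then have "(cmod (expectation J))\<^sup>2 \<le> (expectation (\<lambda>w. cmod (?D w)))\<^sup>2"
      by (intro power_mono) auto
    \<comment> \<open>Cauchy-Schwarz in the form that the variance of the modulus is
      nonnegative.\<close>
    also have "\<dots> \<le> expectation (\<lambda>w. (cmod (?D w))\<^sup>2)"
      using variance_eq[OF int1 int2] variance_positive[of "\<lambda>w. cmod (?D w)"] by linarith
    finally have "ennreal ((cmod (expectation J))\<^sup>2) \<le> ennreal (expectation (\<lambda>w. (cmod (?D w))\<^sup>2))"
      by (rule ennreal_leI)
    also have "\<dots> = e n"
      unfolding e_def by (rule nn_integral_eq_integral[symmetric]) (use int2 in auto)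
    finally show ?thesis using intJ by simp
  qed
  have ev: "eventually (\<lambda>n. e n < top) sequentially"
    by (rule order_tendstoD(2)[OF lim]) simp
  then have ev: "eventually (\<lambda>n. integrable M J \<and> ennreal ((cmod (expectation J))\<^sup>2) \<le> e n) sequentially"
    by eventually_elim (rule bound)
  show "integrable M J"
    using eventually_happens[OF ev] by simp
  have "ennreal ((cmod (expectation J))\<^sup>2) \<le> 0"
    by (rule tendsto_lowerbound[OF lim]) (use eventually_conj_iff[THEN iffD1, OF ev] in simp_all)
  then show "expectation J = 0"
    by (simp add: ennreal_eq_0_iff)
qed

text \<open>Two cases for \<open>f\<close>: either the chosen version is a genuine mean-square
  limit, or there is no limit and the value is the default 0, which is centred too.\<close>

lemma (in prob_space) wiener_integral_expectation:
  assumes "brownian_sheet M B"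
  shows "integrable M (wiener_integral M B f)" "expectation (wiener_integral M B f) = 0"
  using has_wiener_integral_expectation[OF assms, of f] someI_ex[of "has_wiener_integral M B f"]
  by (auto simp: wiener_integral_def)

section \<open>The mean far field\<close>

lemma integrable_vec_componentwise:
  fixes f :: "'b \<Rightarrow> 'c::euclidean_space ^ 'n"
  assumes "\<And>i. integrable M (\<lambda>w. f w $ i)"
  shows "integrable M f"
proof -
  have eq: "f w = (\<Sum>i\<in>UNIV. axis i (f w $ i))" for w
    by (simp add: vec_eq_iff axis_def if_distrib cong: if_cong)
  have "linear (axis i :: 'c \<Rightarrow> 'c ^ 'n)" for i
    by (rule linearI) (simp_all add: vec_eq_iff axis_def)
  then have "bounded_linear (axis i :: 'c \<Rightarrow> 'c ^ 'n)" for i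
    by (simp add: linear_conv_bounded_linear)
  then have "integrable M (\<lambda>w. \<Sum>i\<in>UNIV. axis i (f w $ i))"
    by (intro Bochner_Integration.integrable_sum integrable_bounded_linear[OF _ assms])
  then show ?thesis
    by (simp add: eq[symmetric])
qed

text \<open>Taking a component commutes with the Bochner integral of an integrable function. Without
  integrability the whole vector integral would default to 0.\<close>

lemma integral_vec_component:
  fixes f :: "'b \<Rightarrow> 'c::euclidean_space ^ 'n"
  assumes "\<And>i. integrable M (\<lambda>w. f w $ i)"
  shows "integral\<^sup>L M f $ i = (\<integral>w. f w $ i \<partial>M)"
  by (rule integral_bounded_linear[OF bounded_linear_vec_nth, symmetric])
    (rule integrable_vec_componentwise[OF assms])

text \<open>The part coming from \<open>g\<close> is constant in \<open>w\<close>, and the noise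
  enters linearly through Wiener integrals of mean 0. Hence \<sigma> is absent from the right-hand
  side.\<close>

lemma (in prob_space) expectation_far_field:
  assumes "brownian_sheets M W"
  shows "expectation (far_field a lam mu M W g \<sigma> \<xi> d \<omega>) $ i =
    (let k = wavenumber lam mu \<xi> \<omega> in
      far_field_const k * of_real (k\<^sup>2 / \<omega>\<^sup>2) *
      (LINT y:square a|lebesgue. (\<Sum>j\<in>UNIV. of_real (polarization \<xi> d $ i $ j) *
         exp (- \<i> * of_real (k * (d \<bullet> y))) * of_real (g y $ j))))"
proof -
  have "brownian_sheet M (W j)" for j
    using assms by (simp add: brownian_sheets_def)
  note wiener = wiener_integral_expectation[OF this]
  define k where "k = wavenumber lam mu \<xi> \<omega>"
  define c where "c = far_field_const k * of_real (k\<^sup>2 / \<omega>\<^sup>2)"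
  define K where "K y i j = of_real (polarization \<xi> d $ i $ j) * exp (- \<i> * of_real (k * (d \<bullet> y)))"
    for y and i j :: 2
  define A where "A i = (LINT y:square a|lebesgue. (\<Sum>j\<in>UNIV. K y i j * of_real (g y $ j)))" for i
  define J where "J i j = wiener_integral M (W j)
    (\<lambda>y. indicator (square a) y * (K y i j * of_real (\<sigma> y $ j)))" for i j
  have J: "integrable M (J i j)" "expectation (J i j) = 0" for i j
    unfolding J_def by (rule wiener)+
  have nth: "far_field a lam mu M W g \<sigma> \<xi> d \<omega> w $ i = c * (A i + (\<Sum>j\<in>UNIV. J i j w))" for w i
    by (simp only: far_field_def source_integral_def Let_def k_def[symmetric] c_def A_def J_def K_def
        vector_smult_component vec_lambda_beta)
  have int: "integrable M (\<lambda>w. c * (A i + (\<Sum>j\<in>UNIV. J i j w)))" for i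
    by (intro integrable_mult_right Bochner_Integration.integrable_add Bochner_Integration.integrable_sum J)
      simp
  have "expectation (\<lambda>w. A i + (\<Sum>j\<in>UNIV. J i j w)) = A i + (\<Sum>j\<in>UNIV. expectation (J i j))"
    by (subst Bochner_Integration.integral_add)
      (simp_all add: J Bochner_Integration.integral_sum prob_space)
  then have "expectation (\<lambda>w. c * (A i + (\<Sum>j\<in>UNIV. J i j w))) = c * A i"
    by (simp only: integral_mult_right_zero J sum.neutral_const add_0_right)
  moreover have "expectation (far_field a lam mu M W g \<sigma> \<xi> d \<omega>) $ i =
      expectation (\<lambda>w. far_field a lam mu M W g \<sigma> \<xi> d \<omega> w $ i)"
    by (rule integral_vec_component) (simp only: nth int)
  ultimately show ?thesis
    by (simp only: nth Let_def k_def[symmetric] c_def A_def K_def)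
qed

lemma polarization_sum:
  "polarization Compressional d $ i $ j + polarization Shear d $ i $ j = (if i = j then 1 else 0)"
  by (cases "i = j") (simp_all add: mat_def)

lemma wave_speed_pos:
  assumes "mu > 0" "lam + mu > 0"
  shows "wave_speed lam mu \<xi> > 0"
  using assms by (cases \<xi>) auto

lemma lattice_vec_nonzero:
  assumes "l \<noteq> 0"
  shows "lattice_vec l \<noteq> 0"
  using assms by (simp add: lattice_vec_def vec_eq_iff)

text \<open>The order of quantifiers matters: \<open>c\<close> may depend on the wave type and on
  \<open>l\<close>, but not on the source, so it can be cancelled when two sources are
  compared.\<close>

lemma mean_data_eq_scaled_integral:
  assumes "mu > 0" "lam + mu > 0" "prob_space M" "brownian_sheets M W" "a > 0" "l \<noteq> 0"
  shows "\<exists>c. c \<noteq> 0 \<and> (\<forall>g \<sigma> i. mean_data a lam mu M W \<epsilon> g \<sigma> \<xi> l $ i =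
    c * (LINT y:square a|lebesgue. (\<Sum>j\<in>UNIV. of_real (polarization \<xi> (obs_dir l) $ i $ j) *
         exp (- \<i> * of_real (admissible_freq a \<epsilon> l * (obs_dir l \<bullet> y))) * of_real (g y $ j))))"
proof -
  interpret prob_space M by fact
  define k where "k = admissible_freq a \<epsilon> l"
  define v where "v = wave_speed lam mu \<xi>"
  have k: "k > 0"
    using assms lattice_vec_nonzero[of l] by (simp add: k_def admissible_freq_def)
  have v: "v > 0"
    unfolding v_def using assms(1,2) by (rule wave_speed_pos)
  then have "wavenumber lam mu \<xi> (v * k) = k"
    by (simp add: wavenumber_def v_def)
  moreover have "far_field_const k * of_real (k\<^sup>2 / (v * k)\<^sup>2) \<noteq> 0"
    using k v by (simp add: far_field_const_def)
  ultimately show ?thesis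
    unfolding mean_data_def expectation_far_field[OF assms(4)] v_def[symmetric] k_def[symmetric] Let_def
    by (intro exI[of _ "far_field_const k * of_real (k\<^sup>2 / (v * k)\<^sup>2)"]) simp
qed

section \<open>Integrability on the square and trigonometric estimates\<close>

lemma L2_on_square_integrable:
  assumes "L2_on (square a) f"
  shows "set_integrable lebesgue (square a) f"
proof -
  have "bounded (square a)"
    by (rule bounded_subset[OF bounded_cbox[of "(\<chi> i. - a/2)" "(\<chi> i. a/2)"]])
      (auto simp: square_def mem_box_cart less_imp_le)
  moreover have meas [measurable]: "square a \<in> sets lebesgue"
  proof -
    have "square a = box (\<chi> i. - a/2) (\<chi> i. a/2)"
      by (auto simp: square_def mem_box_cart)
    then show ?thesis by auto
  qed
  ultimately have "square a \<in> lmeasurable"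
    by (simp add: bounded_set_imp_lmeasurable)
  then have "integrable lebesgue (indicat_real (square a))"
    by (simp add: fmeasurable_def integrable_indicator_iff)
  moreover have "integrable lebesgue (\<lambda>x. indicator (square a) x * (f x)\<^sup>2)"
    using assms by (simp add: L2_on_def set_integrable_def)
  \<comment> \<open>The square is bounded, so the constant 1 is integrable on it and
    \<open>1 + f^2\<close> can serve as dominating function.\<close>
  ultimately have I: "integrable lebesgue (\<lambda>x. indicator (square a) x + indicator (square a) x * (f x)\<^sup>2)"
    by auto
  show ?thesis
    unfolding set_integrable_def
  proof (rule Bochner_Integration.integrable_bound[OF I])
    show "(\<lambda>x. indicat_real (square a) x *\<^sub>R f x) \<in> borel_measurable lebesgue"
      using assms by (simp add: L2_on_def set_borel_measurable_def)
    \<comment> \<open>Completing the square at 1/2 gives the sharper bound with 1/4 in place of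
      1.\<close>
    have "\<bar>t\<bar> \<le> 1 + t\<^sup>2" for t :: real
      using sum_power2_ge_zero[of "\<bar>t\<bar> - 1/2" 0] by (simp add: power2_diff power2_eq_square field_simps)
    then show "AE x in lebesgue. norm (indicat_real (square a) x *\<^sub>R f x)
        \<le> norm (indicat_real (square a) x + indicat_real (square a) x * (f x)\<^sup>2)"
      by (auto simp: indicator_def)
  qed
qed

text \<open>The argument for the zeroth mode uses only lattice points \<open>(m, 0)\<close>, where
  the conjugated modes are the powers of one unimodular function of \<open>y $ 1\<close>.\<close>

lemma cnj_fourier_basis_first_axis:
  "cnj (fourier_basis a (vector [m, 0]) y) = exp (- \<i> * of_real (2 * pi / a * (of_int m * y $ 1)))"
  by (simp add: fourier_basis_def lattice_vec_def inner_vec_def sum_2 exp_cnj)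

lemma fourier_basis_zero: "fourier_basis a 0 y = 1"
  by (simp add: fourier_basis_def lattice_vec_def inner_vec_def)

lemma cmod_one_minus_exp_i: "(cmod (1 - exp (- \<i> * of_real t)))\<^sup>2 = 2 - 2 * cos t"
proof -
  have "exp (- \<i> * of_real t) = cis (- t)"
    using cis_conv_exp[of "- t"] by simp
  then have "(cmod (1 - exp (- \<i> * of_real t)))\<^sup>2 = (1 - cos t)\<^sup>2 + (sin t)\<^sup>2"
    by (simp add: cmod_power2)
  also have "\<dots> = 2 - 2 * cos t"
    using sin_cos_squared_add[of t] by (simp add: power2_diff)
  finally show ?thesis .
qed

text \<open>Strictness is the point: with \<open>t = 2 * pi / a * y $ 1\<close>, points of the open
  square have \<open>|t| < pi\<close>, so \<open>2 - 2 * cos t\<close> stays below 4, its value on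
  the edges.\<close>

lemma cos_gt_minus_one:
  assumes "\<bar>t\<bar> < pi"
  shows "cos t > -1"
  using cos_monotone_0_pi[of "\<bar>t\<bar>" pi] assms by simp

lemma set_integrable_mult_cnj_fourier_basis:
  assumes "set_integrable lebesgue S (h :: real^2 \<Rightarrow> complex)"
  shows "set_integrable lebesgue S (\<lambda>y. h y * cnj (fourier_basis a l y))"
proof -
  have c: "continuous_on UNIV (\<lambda>y. cnj (fourier_basis a l y))"
    unfolding fourier_basis_def by (intro continuous_intros)
  have [measurable]: "(\<lambda>y. cnj (fourier_basis a l y)) \<in> borel_measurable lebesgue"
    using borel_measurable_continuous_onI[OF c] by (simp add: measurable_completion)
  have I: "integrable lebesgue (\<lambda>x. indicat_real S x *\<^sub>R h x)"
    using assms by (simp add: set_integrable_def)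
  note [measurable] = borel_measurable_integrable[OF I]
  have "integrable lebesgue (\<lambda>x. (indicat_real S x *\<^sub>R h x) * cnj (fourier_basis a l x))"
  proof (rule Bochner_Integration.integrable_bound[OF I])
    show "(\<lambda>x. (indicat_real S x *\<^sub>R h x) * cnj (fourier_basis a l x)) \<in> borel_measurable lebesgue"
      by measurable
  qed (simp add: norm_mult fourier_basis_def)
  then show ?thesis
    by (simp add: set_integrable_def)
qed

lemma set_integrable_sum:
  fixes f :: "'i \<Rightarrow> 'b \<Rightarrow> 'c::{banach, second_countable_topology}"
  assumes "\<And>i. i \<in> I \<Longrightarrow> set_integrable M A (f i)"
  shows "set_integrable M A (\<lambda>x. \<Sum>i\<in>I. f i x)"
  unfolding set_integrable_def scaleR_sum_right
  by (rule Bochner_Integration.integrable_sum, rule assms[unfolded set_integrable_def])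

lemma set_integral_sum:
  fixes f :: "'i \<Rightarrow> 'b \<Rightarrow> 'c::{banach, second_countable_topology}"
  assumes "\<And>i. i \<in> I \<Longrightarrow> set_integrable M A (f i)"
  shows "(LINT x:A|M. (\<Sum>i\<in>I. f i x)) = (\<Sum>i\<in>I. LINT x:A|M. f i x)"
  unfolding set_lebesgue_integral_def scaleR_sum_right
  by (rule Bochner_Integration.integral_sum, rule assms[unfolded set_integrable_def])

text \<open>Stated almost everywhere because supports here are essential: \<open>h\<close> vanishes
  outside its compact set only up to a null set.\<close>

lemma set_integral_norm_le:
  fixes f :: "'b \<Rightarrow> 'c::{banach, second_countable_topology}"
  assumes "set_integrable M A f" "set_integrable M A g"
    and "AE x\<in>A in M. norm (f x) \<le> g x"
  shows "norm (LINT x:A|M. f x) \<le> (LINT x:A|M. g x)"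
  unfolding set_lebesgue_integral_def
proof (rule order_trans[OF integral_norm_bound integral_mono_AE])
  show "integrable M (\<lambda>x. norm (indicat_real A x *\<^sub>R f x))"
    using assms(1) unfolding set_integrable_def by (rule integrable_norm)
  show "integrable M (\<lambda>x. indicat_real A x *\<^sub>R g x)"
    using assms(2) unfolding set_integrable_def .
  show "AE x in M. norm (indicat_real A x *\<^sub>R f x) \<le> indicat_real A x *\<^sub>R g x"
    using assms(3) by eventually_elim (simp add: indicator_def)
qed

lemma compactly_supported_in_diff:
  assumes "compactly_supported_in S f" "compactly_supported_in S g"
  shows "compactly_supported_in S (\<lambda>x. f x - g x)"
proof -
  obtain K where K: "compact K" "K \<subseteq> S" "AE x in lebesgue. x \<notin> K \<longrightarrow> f x = 0"
    using assms(1) unfolding compactly_supported_in_def by blast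
  obtain L where L: "compact L" "L \<subseteq> S" "AE x in lebesgue. x \<notin> L \<longrightarrow> g x = 0"
    using assms(2) unfolding compactly_supported_in_def by blast
  have "AE x in lebesgue. x \<notin> K \<union> L \<longrightarrow> f x - g x = 0"
    using K(3) L(3) by eventually_elim simp
  moreover have "compact (K \<union> L)" "K \<union> L \<subseteq> S"
    using K L by (simp_all add: compact_Un)
  ultimately show ?thesis
    unfolding compactly_supported_in_def by blast
qed

lemma set_integrable_complex_of_real:
  assumes "set_integrable M A f"
  shows "set_integrable M A (\<lambda>x. complex_of_real (f x))"
  using integrable_of_real[OF assms[unfolded set_integrable_def], where 'a = complex]
  by (simp add: set_integrable_def scaleR_conv_of_real)

section \<open>The zeroth mode from the others\<close>

lemma zero_mode_vanishes:
  fixes h :: "real^2 \<Rightarrow> real"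
  assumes a: "a > 0"
    and h: "set_integrable lebesgue (square a) h"
    and supp: "compactly_supported_in (square a) h"
    and modes: "\<And>l. l \<noteq> 0 \<Longrightarrow> (LINT y:square a|lebesgue. of_real (h y) * cnj (fourier_basis a l y)) = 0"
  shows "(LINT y:square a|lebesgue. complex_of_real (h y)) = 0"
proof -
  obtain K where K: "compact K" "K \<subseteq> square a" "AE x in lebesgue. x \<notin> K \<longrightarrow> h x = 0"
    using supp unfolding compactly_supported_in_def by blast
  \<comment> \<open>\<open>E 1\<close> is the function called \<open>z\<close> in the overview,
    \<open>I m\<close> is the unnormalised Fourier coefficient of \<open>h\<close> at
    \<open>(m, 0)\<close>, and \<open>H\<close> is the L1 norm of \<open>h\<close>.\<close>
  define E where "E m y = cnj (fourier_basis a (vector [m, 0]) y)" for m y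
  define I where "I m = (LINT y:square a|lebesgue. of_real (h y) * E m y)" for m
  define H where "H = (LINT y:square a|lebesgue. \<bar>h y\<bar>)"
  have E: "E m y = exp (- \<i> * of_real (2 * pi / a * (of_int m * y $ 1)))" for m y
    unfolding E_def by (rule cnj_fourier_basis_first_axis)
  have E_add: "E (m + n) y = E m y * E n y" for m n y
    by (simp add: E exp_add[symmetric] algebra_simps)
  have E_power: "E (int k) y = E 1 y ^ k" for k y
    by (induction k) (simp_all add: E_add, simp add: E)
  have E_norm: "cmod (E m y) = 1" for m y
    by (simp add: E)
  have h': "set_integrable lebesgue (square a) (\<lambda>y. complex_of_real (h y))"
    by (rule set_integrable_complex_of_real[OF h])
  have hE: "set_integrable lebesgue (square a) (\<lambda>y. of_real (h y) * E m y)" for m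
    unfolding E_def by (rule set_integrable_mult_cnj_fourier_basis[OF h'])
  have I0: "I 0 = (LINT y:square a|lebesgue. complex_of_real (h y))"
    by (simp add: I_def E)
  have I_nz: "I m = 0" if "m \<noteq> 0" for m
  proof -
    have "vector [m, 0] \<noteq> (0 :: int^2)"
      using that by (simp add: vec_eq_iff forall_2)
    then show ?thesis unfolding I_def E_def by (rule modes)
  qed
  \<comment> \<open>\<open>r\<close> is the maximum of a continuous function on the compact set
    \<open>K\<close>; an empty \<open>K\<close> has no maximum and gets 0.\<close>
  obtain r where r: "0 \<le> r" "r < 4" "\<And>y. y \<in> K \<Longrightarrow> (cmod (1 - E 1 y))\<^sup>2 \<le> r"
  proof (cases "K = {}")
    case True
    then show ?thesis using that[of 0] by auto
  next
    case False
    have "continuous_on K (\<lambda>y. (cmod (1 - E 1 y))\<^sup>2)"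
      unfolding E by (intro continuous_intros)
    then obtain y where y: "y \<in> K" "\<And>x. x \<in> K \<Longrightarrow> (cmod (1 - E 1 x))\<^sup>2 \<le> (cmod (1 - E 1 y))\<^sup>2"
      using continuous_attains_sup[OF K(1) False] by metis
    have "\<bar>y $ 1\<bar> < a / 2"
    proof -
      have "y \<in> square a" using y(1) K(2) by (rule subsetD[rotated])
      then have "- a / 2 < y $ 1 \<and> y $ 1 < a / 2" unfolding square_def by blast
      then show ?thesis by linarith
    qed
    then have "\<bar>2 * pi / a * (of_int 1 * y $ 1)\<bar> < pi"
      using a by (simp add: abs_mult field_simps)
    then have "(cmod (1 - E 1 y))\<^sup>2 < 4"
      unfolding E cmod_one_minus_exp_i using cos_gt_minus_one[of "2 * pi / a * (of_int 1 * y $ 1)"] by linarith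
    then show ?thesis using that[of "(cmod (1 - E 1 y))\<^sup>2"] y(2) by simp
  qed
  \<comment> \<open>The unimodular factor \<open>E (- int n)\<close> leaves the modulus unchanged
    and shifts the frequencies so that the middle binomial term, \<open>k = n\<close>, has frequency
    0.\<close>
  define P where "P n y = E (- int n) y * (1 - E 1 y) ^ (2 * n)" for n y
  have P: "P n y = (\<Sum>k\<le>2*n. of_nat ((2*n) choose k) * (-1) ^ k * E (int k - int n) y)" for n y
  proof -
    have "(1 - E 1 y) ^ (2 * n) = (- E 1 y + 1) ^ (2 * n)" by simp
    also have "\<dots> = (\<Sum>k\<le>2*n. of_nat ((2*n) choose k) * (- E 1 y) ^ k)"
      by (subst binomial_ring) simp
    finally have "P n y = (\<Sum>k\<le>2*n. E (- int n) y * (of_nat ((2*n) choose k) * (- E 1 y) ^ k))"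
      by (simp add: P_def sum_distrib_left)
    also have "\<dots> = (\<Sum>k\<le>2*n. of_nat ((2*n) choose k) * (-1) ^ k * E (int k - int n) y)"
    proof (rule sum.cong[OF refl])
      fix k
      have "E (int k - int n) y = E (int k) y * E (- int n) y"
        using E_add[of "int k" "- int n" y] by simp
      then show "E (- int n) y * (of_nat ((2*n) choose k) * (- E 1 y) ^ k) =
          of_nat ((2*n) choose k) * (-1) ^ k * E (int k - int n) y"
        using power_minus[of "E 1 y" k] by (simp add: E_power)
    qed
    finally show ?thesis .
  qed
  have hP: "of_real (h y) * P n y =
      (\<Sum>k\<le>2*n. (of_nat ((2*n) choose k) * (-1) ^ k) * (of_real (h y) * E (int k - int n) y))" for n y
    unfolding P sum_distrib_left by (simp add: mult_ac)
  have intP: "set_integrable lebesgue (square a) (\<lambda>y. of_real (h y) * P n y)" for n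
    unfolding hP by (intro set_integrable_sum set_integrable_mult_right hE)
  \<comment> \<open>All frequencies \<open>int k - int n\<close> except the one with
    \<open>k = n\<close> are killed by the hypothesis on the modes.\<close>
  have central: "(LINT y:square a|lebesgue. of_real (h y) * P n y) = of_nat ((2*n) choose n) * (-1)^n * I 0" for n
  proof -
    have "(LINT y:square a|lebesgue. of_real (h y) * P n y) =
        (\<Sum>k\<le>2*n. of_nat ((2*n) choose k) * (-1) ^ k * I (int k - int n))"
      unfolding hP I_def
      by (subst set_integral_sum) (simp_all add: hE)
    also have "\<dots> = (\<Sum>k\<le>2*n. if k = n then of_nat ((2*n) choose n) * (-1)^n * I 0 else 0)"
      by (intro sum.cong refl) (simp add: I_nz)
    also have "\<dots> = of_nat ((2*n) choose n) * (-1)^n * I 0"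
      by simp
    finally show ?thesis .
  qed
  \<comment> \<open>On \<open>K\<close> the modulus of \<open>P n\<close> is at most
    \<open>r ^ n\<close>, since \<open>r\<close> bounds the square of
    \<open>cmod (1 - E 1 y)\<close> and the exponent is \<open>2 * n\<close>. Almost everywhere
    outside \<open>K\<close>, \<open>h\<close> is 0.\<close>
  have upper: "real ((2*n) choose n) * cmod (I 0) \<le> r ^ n * H" for n
  proof -
    have "real ((2*n) choose n) * cmod (I 0) = cmod (LINT y:square a|lebesgue. of_real (h y) * P n y)"
      unfolding central by (simp add: norm_mult norm_power)
    also have "\<dots> \<le> (LINT y:square a|lebesgue. r ^ n * \<bar>h y\<bar>)"
    proof (rule set_integral_norm_le[OF intP])
      show "set_integrable lebesgue (square a) (\<lambda>y. r ^ n * \<bar>h y\<bar>)"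
        using h by (intro set_integrable_mult_right set_integrable_abs) auto
      show "AE y\<in>square a in lebesgue. cmod (of_real (h y) * P n y) \<le> r ^ n * \<bar>h y\<bar>"
        using K(3)
      proof eventually_elim
        case (elim y)
        have "cmod (P n y) \<le> r ^ n" if "y \<in> K"
          using power_mono[OF r(3)[OF that], of n]
          by (simp add: P_def norm_mult norm_power E_norm power_mult)
        then show ?case
          using elim by (cases "y \<in> K") (auto simp: norm_mult mult.commute[of _ "\<bar>h y\<bar>"] intro!: mult_left_mono)
      qed
    qed
    also have "\<dots> = r ^ n * H"
      by (simp add: H_def)
    finally show ?thesis .
  qed
  \<comment> \<open>Dividing by the central binomial coefficient, which is at least
    \<open>4 ^ n / (2 * n)\<close> for positive \<open>n\<close>, leaves a geometric factor of ratio
    \<open>r / 4 < 1\<close> that beats the linear factor \<open>n\<close>.\<close>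
  have "cmod (I 0) \<le> 2 * H * (real n * (r / 4) ^ n)" if "n > 0" for n
  proof -
    have "4 ^ n / (2 * real n) * cmod (I 0) \<le> real ((2*n) choose n) * cmod (I 0)"
      using central_binomial_lower_bound[OF that] by (intro mult_right_mono) auto
    also note upper[of n]
    finally show ?thesis using that by (simp add: field_simps)
  qed
  then have "eventually (\<lambda>n. cmod (I 0) \<le> 2 * H * (real n * (r / 4) ^ n)) sequentially"
    by (auto intro: eventually_sequentiallyI[of 1])
  moreover have "(\<lambda>n. 2 * H * (real n * (r / 4) ^ n)) \<longlonglongrightarrow> 2 * H * 0"
    using r by (intro tendsto_mult tendsto_const powser_times_n_limit_0) auto
  ultimately have "cmod (I 0) \<le> 2 * H * 0"
    by (intro tendsto_lowerbound) auto
  then show ?thesis using I0 by simp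
qed

section \<open>The nonzero modes and the conclusion\<close>

lemma plane_wave_eq_cnj_fourier_basis:
  assumes "l \<noteq> 0"
  shows "exp (- \<i> * of_real (admissible_freq a \<epsilon> l * (obs_dir l \<bullet> y))) = cnj (fourier_basis a l y)"
proof -
  \<comment> \<open>The norm of \<open>lattice_vec l\<close> cancels between the frequency and the
    direction.\<close>
  have "admissible_freq a \<epsilon> l * (obs_dir l \<bullet> y) = 2 * pi / a * (lattice_vec l \<bullet> y)"
    using assms lattice_vec_nonzero[OF assms] by (simp add: admissible_freq_def obs_dir_def)
  then show ?thesis
    by (simp only: fourier_basis_def exp_cnj complex_cnj_mult complex_cnj_i complex_cnj_complex_of_real)
qed

text \<open>After cancelling the scaling constant, each wave type yields one projection of the
  coefficient vector, along \<open>obs_dir l\<close> or orthogonal to it. The two projections add up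
  to the vector itself.\<close>

lemma nonzero_mode_determined:
  fixes a lam mu :: real and M :: "'w measure" and W :: "2 \<Rightarrow> real^2 \<Rightarrow> 'w \<Rightarrow> real"
  assumes "a > 0" "mu > 0" "lam + mu > 0" "prob_space M" "brownian_sheets M W"
    and "l \<noteq> 0"
    and g: "\<And>j. set_integrable lebesgue (square a) (\<lambda>y. g y $ j)"
    and g': "\<And>j. set_integrable lebesgue (square a) (\<lambda>y. g' y $ j)"
    and data: "\<And>\<xi>. mean_data a lam mu M W \<epsilon> g \<sigma> \<xi> l = mean_data a lam mu M W \<epsilon> g' \<sigma>' \<xi> l"
  shows "(LINT y:square a|lebesgue. of_real (g y $ i) * cnj (fourier_basis a l y)) =
    (LINT y:square a|lebesgue. of_real (g' y $ i) * cnj (fourier_basis a l y))"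
proof -
  define p where "p \<xi> j = complex_of_real (polarization \<xi> (obs_dir l) $ i $ j)" for \<xi> j
  define F where "F h j = (LINT y:square a|lebesgue. of_real (h y $ j) * cnj (fourier_basis a l y))"
    for h :: "real^2 \<Rightarrow> real^2" and j
  have mode: "(LINT y:square a|lebesgue. (\<Sum>j\<in>UNIV. p \<xi> j * cnj (fourier_basis a l y) * of_real (h y $ j)))
      = (\<Sum>j\<in>UNIV. p \<xi> j * F h j)"
    if h: "\<And>j. set_integrable lebesgue (square a) (\<lambda>y. h y $ j)" for h :: "real^2 \<Rightarrow> real^2" and \<xi>
  proof -
    have I: "set_integrable lebesgue (square a) (\<lambda>y. of_real (h y $ j) * cnj (fourier_basis a l y))" for j
      by (rule set_integrable_mult_cnj_fourier_basis, rule set_integrable_complex_of_real, rule h)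
    have "(LINT y:square a|lebesgue. (\<Sum>j\<in>UNIV. p \<xi> j * (of_real (h y $ j) * cnj (fourier_basis a l y))))
        = (\<Sum>j\<in>UNIV. p \<xi> j * F h j)"
      unfolding F_def by (subst set_integral_sum) (simp_all add: I)
    then show ?thesis
      by (simp only: mult.assoc mult.commute[of "cnj (fourier_basis a l _)"])
  qed
  have eq: "(\<Sum>j\<in>UNIV. p \<xi> j * F g j) = (\<Sum>j\<in>UNIV. p \<xi> j * F g' j)" for \<xi>
  proof -
    obtain c where "c \<noteq> 0" and c: "\<And>g \<sigma>. mean_data a lam mu M W \<epsilon> g \<sigma> \<xi> l $ i =
        c * (LINT y:square a|lebesgue. (\<Sum>j\<in>UNIV. p \<xi> j * cnj (fourier_basis a l y) * of_real (g y $ j)))"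
      using mean_data_eq_scaled_integral[OF assms(2-5,1,6), of \<epsilon> \<xi>] unfolding plane_wave_eq_cnj_fourier_basis[OF \<open>l \<noteq> 0\<close>] p_def by blast
    have "c * (\<Sum>j\<in>UNIV. p \<xi> j * F g j) = c * (\<Sum>j\<in>UNIV. p \<xi> j * F g' j)"
      using data[of \<xi>] c[of g \<sigma>] c[of g' \<sigma>'] by (simp only: mode[OF g] mode[OF g'])
    then show ?thesis using \<open>c \<noteq> 0\<close> by simp
  qed
  have split: "F h i = (\<Sum>j\<in>UNIV. p Compressional j * F h j) + (\<Sum>j\<in>UNIV. p Shear j * F h j)" for h
  proof -
    have "p Compressional j + p Shear j = (if i = j then 1 else 0)" for j
      unfolding p_def of_real_add[symmetric] polarization_sum by simp
    then have "p Compressional j * F h j + p Shear j * F h j = (if i = j then F h j else 0)" for j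
      by (metis distrib_right mult_1 mult_zero_left)
    then show ?thesis
      unfolding sum.distrib[symmetric] by simp
  qed
  have "F g i = F g' i"
    unfolding split[of g] split[of g'] eq ..
  then show ?thesis
    unfolding F_def .
qed

theorem theorem3:
  fixes a lam mu :: real
    and M :: "'w measure"
    and W :: "2 \<Rightarrow> real^2 \<Rightarrow> 'w \<Rightarrow> real"
  assumes "a > 0" and "mu > 0" and "lam + mu > 0"
    and "prob_space M" and "brownian_sheets M W"
  shows "\<exists>\<epsilon>0>0. \<forall>\<epsilon>. 0 < \<epsilon> \<and> \<epsilon> < \<epsilon>0 \<longrightarrow>
    (\<forall>g \<sigma> g' \<sigma>'.
      admissible_source a g \<sigma> \<longrightarrow> admissible_source a g' \<sigma>' \<longrightarrow>
      (\<forall>\<xi> l. mean_data a lam mu M W \<epsilon> g \<sigma> \<xi> l = mean_data a lam mu M W \<epsilon> g' \<sigma>' \<xi> l) \<longrightarrow>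
      (\<forall>l. fourier_coeff a g l = fourier_coeff a g' l))"
\<comment> \<open>The threshold 1 is an arbitrary positive choice: the argument is uniform in
  \<epsilon>.\<close>
proof (intro exI[of _ "1::real"] conjI allI impI)
  fix \<epsilon> g \<sigma> g' \<sigma>' l
  assume src: "admissible_source a g \<sigma>" and src': "admissible_source a g' \<sigma>'"
    and data: "\<forall>\<xi> l. mean_data a lam mu M W \<epsilon> g \<sigma> \<xi> l = mean_data a lam mu M W \<epsilon> g' \<sigma>' \<xi> l"
  have g: "set_integrable lebesgue (square a) (\<lambda>y. g y $ j)" for j
    using src unfolding admissible_source_def by (blast intro: L2_on_square_integrable)
  have g': "set_integrable lebesgue (square a) (\<lambda>y. g' y $ j)" for j
    using src' unfolding admissible_source_def by (blast intro: L2_on_square_integrable)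
  have nonzero: "(LINT y:square a|lebesgue. of_real (g y $ i) * cnj (fourier_basis a l y)) =
      (LINT y:square a|lebesgue. of_real (g' y $ i) * cnj (fourier_basis a l y))" if "l \<noteq> 0" for i l
    by (rule nonzero_mode_determined[OF assms that g g' data[rule_format]])
  \<comment> \<open>By linearity it is enough to treat the difference of the two means, which
    inherits compact support and whose nonzero modes vanish by \<open>nonzero\<close>.\<close>
  have zero: "(LINT y:square a|lebesgue. complex_of_real (g y $ i)) =
      (LINT y:square a|lebesgue. complex_of_real (g' y $ i))" for i
  proof -
    have "(LINT y:square a|lebesgue. complex_of_real (g y $ i - g' y $ i)) = 0"
    proof (rule zero_mode_vanishes)
      show "set_integrable lebesgue (square a) (\<lambda>y. g y $ i - g' y $ i)"
        by (rule set_integral_diff(1)[OF g g'])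
      show "compactly_supported_in (square a) (\<lambda>y. g y $ i - g' y $ i)"
        by (rule compactly_supported_in_diff) (use src src' in \<open>simp_all add: admissible_source_def\<close>)
      show "(LINT y:square a|lebesgue. of_real (g y $ i - g' y $ i) * cnj (fourier_basis a l y)) = 0"
        if "l \<noteq> 0" for l
        unfolding of_real_diff left_diff_distrib
        by (subst set_integral_diff(2))
          (simp_all add: nonzero[OF that] g g' set_integrable_mult_cnj_fourier_basis set_integrable_complex_of_real)
    qed fact
    then show ?thesis
      unfolding of_real_diff
      by (subst (asm) set_integral_diff(2)) (simp_all add: g g' set_integrable_complex_of_real)
  qed
  show "fourier_coeff a g l = fourier_coeff a g' l"
  proof (cases "l = 0")
    case True
    then show ?thesis
      by (simp add: fourier_coeff_def fourier_basis_zero zero)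
  next
    case False
    then show ?thesis
      by (simp only: fourier_coeff_def nonzero[OF False])
  qed
qed simp

end
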